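(* Let $N\ge2$ be an integer, $h=1/N$, $m=N-1$, and $\varepsilon>0$ with $\varepsilon\ll h$. Let $A$ be the $m^2\times m^2$ uniform-mesh five-point finite difference matrix with off-diagonal stencil entries $-\varepsilon^2$ and diagonal entries $4\varepsilon^2+h^2b(x_i,y_j)=\mathcal{O}(h^2)$ (see the context), and let $L$ be its Cholesky factor, $A=LL^T$, in exact arithmetic. For $k\ge1$ let $|L^{[k]}|$ be the number of fill-in entries of $L$ that belong to $L^{[k]}$, the set of entries of magnitude $l^{[k]}$. Then the numbers of fill-in entries of $L$ associated with their magnitude satisfy $$\sum_{k=p}^{m}|L^{[k]}|\le (m-1)(m-p+1)^2,\qquad p\ge1.$$
   Context: **The matrix $A$.** It arises from the symmetrised five-point finite difference discretisation of $-\varepsilon^2\Delta u+b(x,y)u=f(x,y)$ on $(0,1)^2$, with Dirichlet boundary data and $b(x,y)\ge\beta^2>0$, on the uniform mesh $x_i=ih$, $y_j=jh$, $h=1/N$. The unknowns are at the $m^2$ interior points, $1\le i,j\le m=N-1$, in natural (lexicographic) order: point $(x_i,y_j)$ has index $(j-1)m+i$. The diagonal entry of $A$ at the index of $(x_i,y_j)$ is $4\varepsilon^2+h^2b(x_i,y_j)$, which is taken to be $\mathcal{O}(h^2)$ since $\varepsilon\ll h$. The entry coupling two interior points that are nearest horizontal or vertical neighbours in the grid is $-\varepsilon^2$. All other entries are $0$. Thus $A=[a(i,j)]$ is symmetric positive definite with bandwidth $m$. **Cholesky factor.** $L=[l(i,j)]$ is the unique lower triangular matrix with positive diagonal such that $A=LL^T$.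 The fill-in is the set of nonzero entries of $L$ at positions where $A$ has a zero. **Meaning of $\mathcal{O}$.** $f=\mathcal{O}(g)$ means that there are positive constants $C_0,C_1$, independent of $N$ and $\varepsilon$, such that $C_0|g|\le|f|\le C_1|g|$. **The sets $L^{[k]}$.** The entries of $L$ are divided into distinct sets, with all entries of the same magnitude in the same set: $l^{[k]}$ denotes the magnitude of the entries in $L^{[k]}$, that is, $l(i,j)\in L^{[k]}$ if and only if $l(i,j)$ is $\mathcal{O}(l^{[k]})$. For $k=1,\dots,m$ this magnitude is $l^{[k]}=\mathcal{O}(\varepsilon^{2(k+1)}/h^{2k+1})$, and the sets are distinct in the sense that $l^{[k]}\gg l^{[k+1]}$ for $k\ge1$. By convention, $L^{[0]}$ is the set of entries at the positions of nonzero entries of $A$, and entries of $L$ that are zero in exact arithmetic belong to $L^{[\infty]}$. Membership is tracked through the column-by-column computation of $L$: $l(i,j)\in L^{[p_{i,j}]}$, where every $p_{i,j}$ is initially $\infty$ and is updated by $$p_{i,j}=\begin{cases}\min\{0,\;p_{i,1}+p_{j,1}+1,\;\dots,\;p_{i,j-1}+p_{j,j-1}+1\}&\text{if }a(i,j)\ne0,\\ \min\{p_{i,1}+p_{j,1}+1,\;\dots,\;p_{i,j-1}+p_{j,j-1}+1\}&\text{otherwise.}\end{cases}$$ *)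

theory Defs
  imports Complex_Main "HOL-Library.Extended_Nat" "Jordan_Normal_Form.Matrix"
begin

text \<open>
  Matrix indices are 0-based here: the interior point \<open>(x_i, y_j)\<close>, \<open>1 \<le> i, j \<le> m = N - 1\<close>,
  has index \<open>(j - 1) m + (i - 1)\<close>, so that index \<open>r\<close> belongs to the point
  \<open>(x_i, y_j)\<close> with \<open>i = node_x m r\<close> and \<open>j = node_y m r\<close>.
\<close>

definition node_x :: "nat \<Rightarrow> nat \<Rightarrow> nat" where
  "node_x m r = r mod m + 1"

definition node_y :: "nat \<Rightarrow> nat \<Rightarrow> nat" where
  "node_y m r = r div m + 1"

definition grid_neighbours :: "nat \<Rightarrow> nat \<Rightarrow> nat \<Rightarrow> bool" where
  "grid_neighbours m r c \<longleftrightarrow>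
     (node_y m r = node_y m c \<and> (node_x m r = node_x m c + 1 \<or> node_x m c = node_x m r + 1)) \<or>
     (node_x m r = node_x m c \<and> (node_y m r = node_y m c + 1 \<or> node_y m c = node_y m r + 1))"

definition mesh_width :: "nat \<Rightarrow> real" where
  "mesh_width N = 1 / real N"

definition fd_matrix :: "(real \<Rightarrow> real \<Rightarrow> real) \<Rightarrow> nat \<Rightarrow> real \<Rightarrow> real mat" where
  "fd_matrix b N \<epsilon> =
     (let m = N - 1; h = mesh_width N in
      mat (m\<^sup>2) (m\<^sup>2) (\<lambda>(r, c).
        if r = c then 4 * \<epsilon>\<^sup>2 + h\<^sup>2 * b (real (node_x m r) * h) (real (node_y m r) * h)
        else if grid_neighbours m r c then - (\<epsilon>\<^sup>2)
        else 0))"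

definition cholesky_factor :: "real mat \<Rightarrow> real mat \<Rightarrow> bool" where
  "cholesky_factor A L \<longleftrightarrow>
     L \<in> carrier_mat (dim_row A) (dim_row A) \<and>
     (\<forall>i < dim_row A. \<forall>j < dim_row A. i < j \<longrightarrow> L $$ (i, j) = 0) \<and>
     (\<forall>i < dim_row A. L $$ (i, i) > 0) \<and>
     A = L * transpose_mat L"

definition fill_in :: "real mat \<Rightarrow> real mat \<Rightarrow> (nat \<times> nat) set" where
  "fill_in A L =
     {(i, j). i < dim_row A \<and> j < dim_row A \<and> A $$ (i, j) = 0 \<and> L $$ (i, j) \<noteq> 0}"

text \<open>
  The regime \<open>\<epsilon> \<ll> h\<close> is \<open>0 < \<epsilon> \<le> \<delta> h\<close>, where \<open>\<delta>\<close> depends neither on \<open>N\<close> nor on \<open>\<epsilon>\<close>.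
\<close>

definition small_eps :: "real \<Rightarrow> nat \<Rightarrow> real \<Rightarrow> bool" where
  "small_eps \<delta> N \<epsilon> \<longleftrightarrow> 0 < \<epsilon> \<and> \<epsilon> \<le> \<delta> * mesh_width N"

definition magnitude :: "nat \<Rightarrow> nat \<Rightarrow> real \<Rightarrow> real" where
  "magnitude k N \<epsilon> = \<epsilon> ^ (2 * (k + 1)) / mesh_width N ^ (2 * k + 1)"

text \<open>
  The positions, for mesh parameter \<open>N\<close>, of the entries that are of the order of
  \<open>magnitude k\<close> throughout the regime, with the two constants of the (two-sided) order
  relation displayed: \<open>L N \<epsilon>\<close> is the Cholesky factor for the parameters \<open>N\<close>, \<open>\<epsilon>\<close>, and
  \<open>c\<^sub>0\<close>, \<open>c\<^sub>1\<close> are to be fixed before \<open>N\<close> and \<open>\<epsilon>\<close>.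
\<close>

definition magnitude_set ::
  "(nat \<Rightarrow> real \<Rightarrow> real mat) \<Rightarrow> real \<Rightarrow> real \<Rightarrow> real \<Rightarrow> nat \<Rightarrow> nat \<Rightarrow> (nat \<times> nat) set" where
  "magnitude_set L \<delta> c\<^sub>0 c\<^sub>1 N k =
     {(i, j). i < (N - 1)\<^sup>2 \<and> j < (N - 1)\<^sup>2 \<and>
        (\<forall>\<epsilon>. small_eps \<delta> N \<epsilon> \<longrightarrow>
          c\<^sub>0 * \<bar>magnitude k N \<epsilon>\<bar> \<le> \<bar>L N \<epsilon> $$ (i, j)\<bar> \<and>
          \<bar>L N \<epsilon> $$ (i, j)\<bar> \<le> c\<^sub>1 * \<bar>magnitude k N \<epsilon>\<bar>)}"

text \<open>
  The index \<open>p\<^sub>i\<^sub>j\<close> tracked by the column-by-column computation of the factor of \<open>A\<close>; it is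
  meaningful for \<open>j \<le> i\<close>. The infimum of the empty set is \<open>\<infinity>\<close>, the initial value.
\<close>

fun tracked_level :: "real mat \<Rightarrow> nat \<Rightarrow> nat \<Rightarrow> enat" where
  "tracked_level A i j =
     Inf ((if A $$ (i, j) \<noteq> 0 then {0} else {}) \<union>
          (\<lambda>k. tracked_level A i k + tracked_level A j k + 1) ` {..<j})"

declare tracked_level.simps [simp del]

end

theory Submission
  imports Defs
begin

text \<open>
  Two facts carry the proof: the magnitude of an entry of \<open>L\<close> determines its tracked level, and
  large levels are rare because the grid offers short elimination paths.

  \<^bold>\<open>Magnitude and level.\<close> For a fixed mesh the diagonal of the matrix tends to a positive limit as
  \<open>\<epsilon> \<rightarrow> 0\<close>, while every nonzero off-diagonal entry equals \<open>- \<epsilon>\<^sup>2\<close>. In the recursion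
  \<open>l(i,j) = (a(i,j) - (\<Sum>k<j. l(i,k) l(j,k))) / l(j,j)\<close> for \<open>j < i\<close> the quantities \<open>- l(i,j)\<close> are
  quotients of sums of nonnegative terms. Nothing cancels, so orders in \<open>\<epsilon>\<^sup>2\<close> add in products and
  are minimised in sums. These are exactly the rules by which the tracked level plus one is computed,
  and therefore \<open>- l(i,j) / \<epsilon> ^ (2 (p_ij + 1))\<close> has a positive limit if \<open>p_ij\<close> is finite
  (\<open>cholesky_leading_order\<close>). An entry comparable to \<open>\<epsilon> ^ (2 (k + 1))\<close> for all small \<open>\<epsilon>\<close> thus
  has level \<open>k\<close> (\<open>magnitude_set_tracked_level\<close>), and the first inequality follows from the second.

  \<^bold>\<open>Counting levels.\<close> The level of \<open>(i,j)\<close> is one less than the length of a shortest path from \<open>i\<close>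
  to \<open>j\<close> in the grid whose interior vertices are all numbered below \<open>j\<close>. The bandwidth confines
  fill-in to two kinds of position. If \<open>i\<close> lies in the row after that of \<open>j\<close>, \<open>s\<close> columns to the
  left, one step down and \<open>s\<close> steps along the row of \<open>j\<close> give level at most \<open>s\<close>. If \<open>i\<close> lies in
  the row of \<open>j\<close>, \<open>s\<close> columns to the right, the detour through the preceding row gives level at
  most \<open>s + 1\<close>; within the first row there is no such detour and no fill-in. Level at least \<open>p\<close> hence forces
  \<open>s \<ge> p\<close> or \<open>s \<ge> p - 1\<close>. With \<open>q = m - p + 1\<close>, for each of the \<open>m - 1\<close> pairs of
  consecutive rows the positions of the second kind fill at most the closed triangle \<open>u \<le> v\<close> of a
  \<open>q \<times> q\<close> square, and those of the first kind the complementary open triangle \<open>v < u\<close>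
  (\<open>card_levels_ge_le\<close>). The resulting bound is \<open>(m - 1) q\<^sup>2\<close>.
\<close>

section \<open>Leading orders of functions at zero\<close>

text \<open>
  Orders count powers of \<open>e\<^sup>2\<close>. The limit is required to be positive, not merely nonzero, so
  that leading terms cannot cancel in sums; order \<open>\<infinity>\<close> means vanishing near zero, so that sums over
  empty index sets and structural zeros fit the same calculus.
\<close>

definition leading_order :: "(real \<Rightarrow> real) \<Rightarrow> enat \<Rightarrow> bool" where
  "leading_order f n \<longleftrightarrow>
     (case n of
        enat k \<Rightarrow> \<exists>l>0. ((\<lambda>e. f e / e ^ (2 * k)) \<longlongrightarrow> l) (at_right 0)
      | \<infinity> \<Rightarrow> \<forall>\<^sub>F e in at_right 0. f e = 0)"

lemma leading_order_enat:
  "leading_order f (enat k) \<longleftrightarrow> (\<exists>l>0. ((\<lambda>e. f e / e ^ (2 * k)) \<longlongrightarrow> l) (at_right 0))"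
  by (simp add: leading_order_def)

lemma leading_order_infinity:
  "leading_order f \<infinity> \<longleftrightarrow> (\<forall>\<^sub>F e in at_right 0. f e = 0)"
  by (simp add: leading_order_def)

lemma leading_order_cong:
  assumes "leading_order f n" "\<forall>\<^sub>F e in at_right 0. g e = f e"
  shows "leading_order g n"
proof (cases n)
  case (enat k)
  then obtain l where l: "l > 0" "((\<lambda>e. f e / e ^ (2 * k)) \<longlongrightarrow> l) (at_right 0)"
    using assms(1) by (auto simp: leading_order_enat)
  have "((\<lambda>e. g e / e ^ (2 * k)) \<longlongrightarrow> l) (at_right 0)"
    by (rule tendsto_cong[THEN iffD2, OF _ l(2)]) (use assms(2) in eventually_elim, simp)
  then show ?thesis using l(1) enat by (auto simp: leading_order_enat)
next
  case infinity
  with assms have "\<forall>\<^sub>F e in at_right 0. f e = 0" by (simp add: leading_order_infinity)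
  with assms(2) have "\<forall>\<^sub>F e in at_right 0. g e = 0" by eventually_elim simp
  then show ?thesis using infinity by (simp add: leading_order_infinity)
qed

lemma tendsto_zero_below_leading_order:
  assumes "leading_order f n" "enat k < n"
  shows "((\<lambda>e. f e / e ^ (2 * k)) \<longlongrightarrow> 0) (at_right 0)"
proof (cases n)
  case (enat n')
  then obtain l where l: "((\<lambda>e. f e / e ^ (2 * n')) \<longlongrightarrow> l) (at_right 0)"
    using assms(1) by (auto simp: leading_order_enat)
  have kn: "k < n'" using assms(2) enat by simp
  have "((\<lambda>e::real. e ^ (2 * (n' - k))) \<longlongrightarrow> 0 ^ (2 * (n' - k))) (at_right 0)"
    by (intro tendsto_intros)
  then have "((\<lambda>e. (f e / e ^ (2 * n')) * e ^ (2 * (n' - k))) \<longlongrightarrow> l * 0) (at_right 0)"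
    using kn by (intro tendsto_mult l) (simp add: zero_power)
  moreover have "\<forall>\<^sub>F e in at_right 0. f e / e ^ (2 * k) = (f e / e ^ (2 * n')) * e ^ (2 * (n' - k))"
    using eventually_at_right_less[of "0::real"]
  proof eventually_elim
    case (elim e)
    have "e ^ (2 * n') = e ^ (2 * k) * e ^ (2 * (n' - k))"
      unfolding power_add[symmetric] using kn by (intro arg_cong[where f = "(^) e"]) simp
    then show ?case using elim by simp
  qed
  ultimately show ?thesis by (simp add: tendsto_cong)
next
  case infinity
  then have "\<forall>\<^sub>F e in at_right 0. f e / e ^ (2 * k) = 0"
    using assms(1) by (auto simp: leading_order_infinity elim: eventually_mono)
  then show ?thesis by (rule tendsto_eventually)
qed

lemma leading_order_zero: "leading_order (\<lambda>e. 0) \<infinity>"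
  by (simp add: leading_order_infinity)

lemma leading_order_square: "leading_order (\<lambda>e. e\<^sup>2) 1"
proof -
  have "\<forall>\<^sub>F e in at_right (0::real). e\<^sup>2 / e ^ (2 * 1) = 1"
    using eventually_at_right_less[of "0::real"] by eventually_elim simp
  then have "((\<lambda>e::real. e\<^sup>2 / e ^ (2 * 1)) \<longlongrightarrow> 1) (at_right 0)"
    by (rule tendsto_eventually)
  then show ?thesis unfolding one_enat_def leading_order_enat by (intro exI[of _ 1]) simp
qed

lemma leading_order_mult:
  assumes "leading_order f a" "leading_order g b"
  shows "leading_order (\<lambda>e. f e * g e) (a + b)"
proof (cases "a = \<infinity> \<or> b = \<infinity>")
  case True
  then have "\<forall>\<^sub>F e in at_right 0. f e * g e = 0"
  proof
    assume "a = \<infinity>"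
    then show ?thesis
      using assms(1) by (auto simp: leading_order_infinity elim: eventually_mono)
  next
    assume "b = \<infinity>"
    then show ?thesis
      using assms(2) by (auto simp: leading_order_infinity elim: eventually_mono)
  qed
  moreover have "a + b = \<infinity>" using True by auto
  ultimately show ?thesis by (simp add: leading_order_infinity)
next
  case False
  then obtain a' b' where ab: "a = enat a'" "b = enat b'" by auto
  obtain l where l: "l > 0" "((\<lambda>e. f e / e ^ (2 * a')) \<longlongrightarrow> l) (at_right 0)"
    using assms(1) ab by (auto simp: leading_order_enat)
  obtain l' where l': "l' > 0" "((\<lambda>e. g e / e ^ (2 * b')) \<longlongrightarrow> l') (at_right 0)"
    using assms(2) ab by (auto simp: leading_order_enat)
  have "((\<lambda>e. f e * g e / e ^ (2 * (a' + b'))) \<longlongrightarrow> l * l') (at_right 0)"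
    using tendsto_mult[OF l(2) l'(2)] by (simp add: power_add distrib_left)
  then show ?thesis
    using l(1) l'(1) ab by (auto simp: leading_order_enat intro!: exI[of _ "l * l'"])
qed

text \<open>
  The minimum is exact because both leading coefficients are positive.
\<close>

lemma leading_order_add:
  assumes "leading_order f a" "leading_order g b"
  shows "leading_order (\<lambda>e. f e + g e) (min a b)"
proof -
  have less: "leading_order (\<lambda>e. f e + g e) a"
    if fg: "leading_order f a" "leading_order g b" and ab: "a < b" for f g a b
  proof -
    obtain k where k: "a = enat k" using ab by (cases a) auto
    obtain l where l: "l > 0" "((\<lambda>e. f e / e ^ (2 * k)) \<longlongrightarrow> l) (at_right 0)"
      using fg(1) k by (auto simp: leading_order_enat)
    have "((\<lambda>e. f e / e ^ (2 * k) + g e / e ^ (2 * k)) \<longlongrightarrow> l + 0) (at_right 0)"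
      using tendsto_zero_below_leading_order[OF fg(2)] ab k by (intro tendsto_add l(2)) auto
    then show ?thesis
      using l(1) k by (auto simp: leading_order_enat add_divide_distrib)
  qed
  consider "a < b" | "b < a" | "a = b" by fastforce
  then show ?thesis
  proof cases
    case 1
    then show ?thesis using less[OF assms] by (simp add: min_absorb1)
  next
    case 2
    then show ?thesis
      using less[OF assms(2,1)] by (simp add: min_absorb2 add.commute)
  next
    case 3
    show ?thesis
    proof (cases a)
      case (enat k)
      obtain l where l: "l > 0" "((\<lambda>e. f e / e ^ (2 * k)) \<longlongrightarrow> l) (at_right 0)"
        using assms(1) enat by (auto simp: leading_order_enat)
      obtain l' where l': "l' > 0" "((\<lambda>e. g e / e ^ (2 * k)) \<longlongrightarrow> l') (at_right 0)"
        using assms(2) enat 3 by (auto simp: leading_order_enat)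
      have "((\<lambda>e. (f e + g e) / e ^ (2 * k)) \<longlongrightarrow> l + l') (at_right 0)"
        using tendsto_add[OF l(2) l'(2)] by (simp add: add_divide_distrib)
      then show ?thesis
        using l(1) l'(1) enat 3 by (auto simp: leading_order_enat intro!: exI[of _ "l + l'"])
    next
      case infinity
      then show ?thesis
        using assms 3 by (auto simp: leading_order_infinity elim: eventually_elim2)
    qed
  qed
qed

lemma leading_order_sum:
  assumes "finite K" "\<And>k. k \<in> K \<Longrightarrow> leading_order (f k) (n k)"
  shows "leading_order (\<lambda>e. \<Sum>k\<in>K. f k e) (Inf (n ` K))"
  using assms
proof (induction K rule: finite_induct)
  case empty
  then show ?case by (simp add: leading_order_infinity Inf_enat_def)
next
  case (insert x K)
  then show ?case
    using leading_order_add[of "f x" "n x" "\<lambda>e. \<Sum>k\<in>K. f k e" "Inf (n ` K)"]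
    by (simp add: inf_min)
qed

lemma leading_order_divide:
  assumes "leading_order f n" "(g \<longlongrightarrow> d) (at_right 0)" "d > 0"
  shows "leading_order (\<lambda>e. f e / g e) n"
proof -
  have "((\<lambda>e. inverse (g e) / e ^ (2 * 0)) \<longlongrightarrow> inverse d) (at_right 0)"
    using assms(2,3) by (auto intro: tendsto_inverse)
  then have "leading_order (\<lambda>e. inverse (g e)) (enat 0)"
    unfolding leading_order_enat using assms(3) by (intro exI[of _ "inverse d"]) auto
  from leading_order_mult[OF assms(1) this] show ?thesis
    by (simp add: divide_inverse zero_enat_def[symmetric])
qed

text \<open>
  This recovers the order of a function from a two-sided order relation.
\<close>

lemma leading_order_unique:
  assumes f: "leading_order f n" and c: "c > 0" "C > 0"
    and bounds: "\<forall>\<^sub>F e in at_right 0. c * e ^ (2 * k) \<le> \<bar>f e\<bar> \<and> \<bar>f e\<bar> \<le> C * e ^ (2 * k)"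
  shows "n = enat k"
proof -
  have pos: "\<forall>\<^sub>F e in at_right (0::real). 0 < e" by (rule eventually_at_right_less)
  have lower: "\<forall>\<^sub>F e in at_right 0. c \<le> \<bar>f e / e ^ (2 * k)\<bar>"
    using bounds pos by eventually_elim (simp add: field_simps abs_divide)
  have "\<not> enat k < n"
  proof
    assume "enat k < n"
    from tendsto_rabs[OF tendsto_zero_below_leading_order[OF f this]] lower have "c \<le> \<bar>0\<bar>"
      by (rule tendsto_lowerbound) simp
    then show False using c by simp
  qed
  moreover have "\<not> n < enat k"
  proof
    assume n: "n < enat k"
    then obtain j where j: "n = enat j" "j < k" by (cases n) auto
    obtain l where l: "l > 0" "((\<lambda>e. f e / e ^ (2 * j)) \<longlongrightarrow> l) (at_right 0)"
      using f j by (auto simp: leading_order_enat)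
    have ok: "leading_order (\<lambda>e. C * e ^ (2 * k)) (enat k)"
    proof -
      have "\<forall>\<^sub>F e in at_right (0::real). C * e ^ (2 * k) / e ^ (2 * k) = C"
        using pos by eventually_elim simp
      then show ?thesis
        unfolding leading_order_enat using c(2) by (intro exI[of _ C] conjI tendsto_eventually)
    qed
    have "\<forall>\<^sub>F e in at_right 0. f e / e ^ (2 * j) \<le> C * e ^ (2 * k) / e ^ (2 * j)"
      using bounds pos by eventually_elim (intro divide_right_mono, auto)
    then have "l \<le> 0"
      using tendsto_le[OF _ tendsto_zero_below_leading_order[OF ok] l(2)] j(2) by simp
    then show False using l(1) by simp
  qed
  ultimately show ?thesis by (simp add: not_less)
qed

section \<open>Leading orders of the entries of a Cholesky factor\<close>

lemma cholesky_pivot_pos: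
  "cholesky_factor A L \<Longrightarrow> j < dim_row A \<Longrightarrow> L $$ (j, j) > 0"
  unfolding cholesky_factor_def by simp

text \<open>
  The product \<open>L L\<^sup>T\<close> read entrywise: row \<open>j\<close> of \<open>L\<close> ends at the diagonal, so only the columns up
  to \<open>j\<close> contribute.
\<close>

lemma cholesky_entry:
  assumes chol: "cholesky_factor A L" and j: "j \<le> i" and i: "i < dim_row A"
  shows "A $$ (i, j) = (\<Sum>k<j. L $$ (i, k) * L $$ (j, k)) + L $$ (i, j) * L $$ (j, j)"
proof -
  let ?n = "dim_row A"
  note chol = chol[unfolded cholesky_factor_def]
  have L: "L \<in> carrier_mat ?n ?n" by (rule chol[THEN conjunct1])
  have up: "L $$ (i, j) = 0" if "i < j" "j < ?n" for i j
    using chol[THEN conjunct2, THEN conjunct1] that by (meson less_trans)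
  have A: "A = L * transpose_mat L"
    by (rule chol[THEN conjunct2, THEN conjunct2, THEN conjunct2])
  have jn: "j < ?n" using i j by simp
  have "A $$ (i, j) = (L * transpose_mat L) $$ (i, j)"
    by (rule arg_cong[OF A, of "\<lambda>M. M $$ (i, j)"])
  also have "\<dots> = (\<Sum>k = 0..<?n. L $$ (i, k) * L $$ (j, k))"
    using L i jn by (simp add: scalar_prod_def)
  also have "\<dots> = (\<Sum>k\<le>j. L $$ (i, k) * L $$ (j, k))"
    using jn up by (intro sum.mono_neutral_right) auto
  also have "\<dots> = (\<Sum>k<j. L $$ (i, k) * L $$ (j, k)) + L $$ (i, j) * L $$ (j, j)"
    by (simp flip: lessThan_Suc_atMost)
  finally show ?thesis .
qed

lemma eSuc_Inf: "eSuc (Inf S) = Inf (eSuc ` S)"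
proof (cases "S = {}")
  case False
  have "Inf S \<in> S" using False by (auto simp: Inf_enat_def intro: LeastI)
  then show ?thesis
    by (intro antisym INF_greatest INF_lower) (auto intro: Inf_lower)
qed (simp add: Inf_enat_def)

text \<open>
  Shifted by one, the recursion for levels matches the calculus of leading orders: a nonzero entry
  of the matrix has order \<open>1\<close>, a product has the sum of the orders of its factors, and a sum has
  the minimum of the orders of its terms.
\<close>

lemma tracked_level_eq_plus_one:
  "tracked_level A i j + 1 =
     min (if A $$ (i, j) \<noteq> 0 then 1 else \<infinity>)
         (INF k\<in>{..<j}. (tracked_level A i k + 1) + (tracked_level A j k + 1))"
proof -
  have "tracked_level A i j + 1 = eSuc (tracked_level A i j)"
    by (simp add: plus_1_eSuc)
  also have "\<dots> = Inf (eSuc ` ((if A $$ (i, j) \<noteq> 0 then {0} else {}) \<union>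
          (\<lambda>k. tracked_level A i k + tracked_level A j k + 1) ` {..<j}))"
    by (subst tracked_level.simps) (rule eSuc_Inf)
  also have "\<dots> = min (if A $$ (i, j) \<noteq> 0 then 1 else \<infinity>)
       (INF k\<in>{..<j}. (tracked_level A i k + 1) + (tracked_level A j k + 1))"
    by (simp add: image_Un image_image Inf_union_distrib inf_min plus_1_eSuc[symmetric]
        add_ac one_eSuc[symmetric] del: lessThan_iff)
  finally show ?thesis .
qed

text \<open>
  Induction over the columns. The entries of row \<open>j\<close> left of the diagonal have order at least \<open>1\<close> and
  vanish in the limit, so the pivot tends to \<open>sqrt (d j) > 0\<close> and dividing by it preserves orders.
  All \<open>A e\<close> share the sparsity pattern of \<open>B\<close>, from which the levels are read off.
\<close>

lemma cholesky_leading_order: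
  fixes A L :: "real \<Rightarrow> real mat" and B :: "real mat"
  assumes chol: "\<forall>\<^sub>F e in at_right 0. cholesky_factor (A e) (L e)"
    and dim: "\<And>e. dim_row (A e) = n"
    and offdiag: "\<And>e i j. j < i \<Longrightarrow> i < n \<Longrightarrow>
      A e $$ (i, j) = (if B $$ (i, j) \<noteq> 0 then - (e\<^sup>2) else 0)"
    and diag: "\<And>i. i < n \<Longrightarrow> ((\<lambda>e. A e $$ (i, i)) \<longlongrightarrow> d i) (at_right 0)"
    and pos: "\<And>i. i < n \<Longrightarrow> d i > 0"
    and ij: "j < i" "i < n"
  shows "leading_order (\<lambda>e. - L e $$ (i, j)) (tracked_level B i j + 1)"
  using ij
proof (induction j arbitrary: i rule: less_induct)
  case (less j)
  let ?l = "\<lambda>i j. tracked_level B i j + 1"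
  have j: "j < n" using less.prems by simp
  have IH: "leading_order (\<lambda>e. - L e $$ (i', k)) (?l i' k)" if "k < j" "k < i'" "i' < n" for i' k
    using less.IH that by blast
  have row_j: "((\<lambda>e. L e $$ (j, k)) \<longlongrightarrow> 0) (at_right 0)" if "k < j" for k
  proof -
    have "enat 0 < ?l j k" by (simp add: zero_enat_def[symmetric])
    from tendsto_zero_below_leading_order[OF IH[OF that that j] this]
    have "((\<lambda>e. - L e $$ (j, k)) \<longlongrightarrow> 0) (at_right 0)" by simp
    from tendsto_minus[OF this] show ?thesis by simp
  qed
  have pivot: "((\<lambda>e. L e $$ (j, j)) \<longlongrightarrow> sqrt (d j)) (at_right 0)"
  proof -
    have "((\<lambda>e. A e $$ (j, j) - (\<Sum>k<j. L e $$ (j, k) * L e $$ (j, k)))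
        \<longlongrightarrow> d j - (\<Sum>k<j. 0 * 0)) (at_right 0)"
      using row_j by (intro tendsto_diff tendsto_sum tendsto_mult diag[OF j]) auto
    then have "((\<lambda>e. sqrt (A e $$ (j, j) - (\<Sum>k<j. L e $$ (j, k) * L e $$ (j, k))))
        \<longlongrightarrow> sqrt (d j)) (at_right 0)"
      by (intro tendsto_real_sqrt) simp
    moreover have "\<forall>\<^sub>F e in at_right 0.
        L e $$ (j, j) = sqrt (A e $$ (j, j) - (\<Sum>k<j. L e $$ (j, k) * L e $$ (j, k)))"
      using chol
    proof eventually_elim
      case (elim e)
      have "L e $$ (j, j) > 0" using cholesky_pivot_pos[OF elim] j dim by simp
      then show ?case using cholesky_entry[OF elim order_refl, of j] j dim by simp
    qed
    ultimately show ?thesis by (simp add: tendsto_cong)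
  qed
  have "leading_order (\<lambda>e. if B $$ (i, j) \<noteq> 0 then e\<^sup>2 else 0) (if B $$ (i, j) \<noteq> 0 then 1 else \<infinity>)"
    using leading_order_square leading_order_zero by simp
  moreover have "leading_order (\<lambda>e. \<Sum>k<j. - L e $$ (i, k) * - L e $$ (j, k))
      (INF k\<in>{..<j}. ?l i k + ?l j k)"
    using less.prems j by (intro leading_order_sum leading_order_mult IH) auto
  ultimately have "leading_order
      (\<lambda>e. (if B $$ (i, j) \<noteq> 0 then e\<^sup>2 else 0) + (\<Sum>k<j. - L e $$ (i, k) * - L e $$ (j, k))) (?l i j)"
    unfolding tracked_level_eq_plus_one[of B i j] by (rule leading_order_add)
  from leading_order_divide[OF this pivot]
  have "leading_order (\<lambda>e. ((if B $$ (i, j) \<noteq> 0 then e\<^sup>2 else 0)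
      + (\<Sum>k<j. - L e $$ (i, k) * - L e $$ (j, k))) / L e $$ (j, j)) (?l i j)"
    using pos[OF j] by simp
  then show ?case
  proof (rule leading_order_cong)
    show "\<forall>\<^sub>F e in at_right 0. - L e $$ (i, j) = ((if B $$ (i, j) \<noteq> 0 then e\<^sup>2 else 0)
      + (\<Sum>k<j. - L e $$ (i, k) * - L e $$ (j, k))) / L e $$ (j, j)"
      using chol
    proof eventually_elim
      case (elim e)
      have "L e $$ (j, j) > 0" using cholesky_pivot_pos[OF elim] j dim by simp
      moreover have "A e $$ (i, j) = (\<Sum>k<j. L e $$ (i, k) * L e $$ (j, k)) + L e $$ (i, j) * L e $$ (j, j)"
        using cholesky_entry[OF elim] less.prems dim by simp
      ultimately show ?case
        using offdiag[OF less.prems, of e] by (auto simp: field_simps split: if_splits)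
    qed
  qed
qed

section \<open>Levels as lengths of elimination paths\<close>

lemma tracked_level_edge:
  assumes "A $$ (i, j) \<noteq> 0"
  shows "tracked_level A i j = 0"
  using assms by (subst tracked_level.simps) (simp add: inf_absorb1)

text \<open>
  Two paths that meet at a vertex \<open>k < j\<close> may be joined there.
\<close>

lemma tracked_level_eliminate:
  assumes "k < j" "tracked_level A i k \<le> enat a" "tracked_level A j k \<le> enat b"
  shows "tracked_level A i j \<le> enat (a + b + 1)"
proof -
  have "tracked_level A i k + tracked_level A j k + 1 \<in>
      (if A $$ (i, j) \<noteq> 0 then {0} else {}) \<union>
      (\<lambda>k. tracked_level A i k + tracked_level A j k + 1) ` {..<j}"
    using assms(1) by blast
  then have "tracked_level A i j \<le> tracked_level A i k + tracked_level A j k + 1"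
    by (subst tracked_level.simps) (rule Inf_lower)
  also have "\<dots> \<le> enat a + enat b + 1"
    using assms(2,3) by (intro add_mono order_refl)
  finally show ?thesis by (simp add: one_enat_def)
qed

lemma tracked_level_finite_cases:
  assumes "tracked_level A i j \<noteq> \<infinity>"
  obtains "A $$ (i, j) \<noteq> 0"
  | k where "k < j" "tracked_level A i k \<noteq> \<infinity>" "tracked_level A j k \<noteq> \<infinity>"
proof (rule ccontr)
  assume neg: "\<not> thesis"
  have z: "A $$ (i, j) = 0" using neg that(1) by blast
  have "x = \<infinity>" if "x \<in> (\<lambda>k. tracked_level A i k + tracked_level A j k + 1) ` {..<j}" for x
    using neg \<open>\<And>k. k < j \<Longrightarrow> _ \<Longrightarrow> _ \<Longrightarrow> thesis\<close> that by fastforce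
  then have "\<infinity> \<le> Inf ((\<lambda>k. tracked_level A i k + tracked_level A j k + 1) ` {..<j})"
    by (intro Inf_greatest) simp
  then show False using assms z tracked_level.simps[of A i j] by simp
qed

text \<open>
  A path that reaches \<open>j\<close> through lower vertices must leave \<open>i\<close> by an edge to a vertex below \<open>j\<close> or
  to \<open>j\<close> itself, so fill-in stays within the band of the matrix.
\<close>

lemma tracked_level_bandwidth:
  assumes fin: "tracked_level A i j \<noteq> \<infinity>" and "j < i" "i < n"
    and band: "\<And>i j. j < i \<Longrightarrow> i < n \<Longrightarrow> A $$ (i, j) \<noteq> 0 \<Longrightarrow> i \<le> j + w"
  shows "i \<le> j + w"
  using assms(1-3)
proof (induction j rule: less_induct)
  case (less j)
  from less.prems(1) show ?case
  proof (cases rule: tracked_level_finite_cases)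
    case 1
    then show ?thesis using band less.prems by blast
  next
    case (2 k)
    then show ?thesis using less.IH[of k] less.prems by simp
  qed
qed

section \<open>The five-point matrix and its grid\<close>

lemma fd_matrix_dim: "dim_row (fd_matrix b N e) = (N - 1)\<^sup>2"
  by (simp add: fd_matrix_def Let_def)

lemma fd_matrix_offdiag:
  assumes "j < i" "i < (N - 1)\<^sup>2"
  shows "fd_matrix b N e $$ (i, j) = (if grid_neighbours (N - 1) i j then - (e\<^sup>2) else 0)"
  using assms by (simp add: fd_matrix_def Let_def)

lemma fd_matrix_diag:
  assumes "i < (N - 1)\<^sup>2"
  shows "fd_matrix b N e $$ (i, i) =
    4 * e\<^sup>2 + (mesh_width N)\<^sup>2 *
      b (real (node_x (N - 1) i) * mesh_width N) (real (node_y (N - 1) i) * mesh_width N)"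
  using assms by (simp add: fd_matrix_def Let_def)

text \<open>
  Interior mesh points lie in the open unit square, where the lower bound on \<open>b\<close> is available. The
  quantity is the limit of a diagonal entry of the matrix as \<open>\<epsilon> \<rightarrow> 0\<close>.
\<close>

lemma reaction_pos:
  assumes "\<beta> > 0" "\<And>x y. x \<in> {0<..<1} \<Longrightarrow> y \<in> {0<..<1} \<Longrightarrow> b x y \<ge> \<beta>\<^sup>2"
    and "i < (N - 1)\<^sup>2"
  shows "(mesh_width N)\<^sup>2 *
      b (real (node_x (N - 1) i) * mesh_width N) (real (node_y (N - 1) i) * mesh_width N) > 0"
proof -
  have m: "N - 1 > 0" using assms(3) by (cases "N - 1") auto
  have "node_x (N - 1) i < N"
    using m mod_less_divisor[OF m, of i] unfolding node_x_def by linarith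
  moreover have "i div (N - 1) < N - 1"
    using assms(3) by (simp add: power2_eq_square less_mult_imp_div_less)
  then have "node_y (N - 1) i < N" unfolding node_y_def by linarith
  ultimately have "real (node_x (N - 1) i) * mesh_width N \<in> {0<..<1}"
    "real (node_y (N - 1) i) * mesh_width N \<in> {0<..<1}"
    using m by (auto simp: mesh_width_def node_x_def node_y_def)
  from assms(2)[OF this] have "b (real (node_x (N - 1) i) * mesh_width N)
      (real (node_y (N - 1) i) * mesh_width N) > 0"
    using assms(1) by (meson less_le_trans zero_less_power)
  then show ?thesis using m by (simp add: mesh_width_def)
qed

lemma grid_neighbours_iff:
  assumes "c < m" "c' < m"
  shows "grid_neighbours m (r * m + c) (r' * m + c') \<longleftrightarrow>
    r = r' \<and> (c = c' + 1 \<or> c' = c + 1) \<or> c = c' \<and> (r = r' + 1 \<or> r' = r + 1)"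
  using assms by (simp add: grid_neighbours_def node_x_def node_y_def)

lemma grid_neighbours_cases:
  assumes "grid_neighbours m i j" "j < i"
  obtains "i = j + 1" "i div m = j div m" | "i = j + m"
proof -
  have i: "i = i div m * m + i mod m" and j: "j = j div m * m + j mod m" by simp_all
  have le: "j div m \<le> i div m" using assms(2) by (simp add: div_le_mono)
  consider "i div m = j div m" "i mod m = j mod m + 1" | "i div m = j div m" "j mod m = i mod m + 1"
    | "i mod m = j mod m" "i div m = j div m + 1"
    using assms(1) le by (auto simp: grid_neighbours_def node_x_def node_y_def)
  then show ?thesis
  proof cases
    case 1
    then have "i = j + 1" using i j by (metis add.assoc)
    then show ?thesis using that(1) 1 by blast
  next
    case 2
    then have "j = i + 1" using i j by (metis add.assoc)
    then show ?thesis using assms(2) by simp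
  next
    case 3
    then have "i = (j div m + 1) * m + j mod m" using i by metis
    then have "i = j + m" using j by (simp add: algebra_simps)
    then show ?thesis by (rule that(2))
  qed
qed

text \<open>
  The path steps from column \<open>c\<close> of row \<open>r + 1\<close> to row \<open>r\<close> and then moves right. In row \<open>r\<close> it
  meets only vertices numbered below its end point.
\<close>

lemma tracked_level_next_row_le:
  assumes pattern: "\<And>i j. j < i \<Longrightarrow> i < m\<^sup>2 \<Longrightarrow> A $$ (i, j) \<noteq> 0 \<longleftrightarrow> grid_neighbours m i j"
    and "r + 1 < m" "c + s < m"
  shows "tracked_level A ((r + 1) * m + c) (r * m + c + s) \<le> enat s"
proof -
  let ?i = "(r + 1) * m + c"
  have "(r + 1) * m + m \<le> m * m"
    using mult_le_mono1[of "r + 2" m m] assms(2) by (simp add: add_mult_distrib)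
  then have i: "?i < m\<^sup>2" using assms(3) by (simp add: power2_eq_square)
  show ?thesis
    using assms(3)
  proof (induction s)
    case 0
    then have "A $$ (?i, r * m + c) \<noteq> 0"
      using pattern[OF _ i, of "r * m + c"] grid_neighbours_iff[of c m c "r + 1" r] by simp
    then show ?case using tracked_level_edge by (simp add: zero_enat_def)
  next
    case (Suc s)
    let ?j = "r * m + (c + Suc s)" and ?k = "r * m + (c + s)"
    have "?j < ?i" using Suc.prems by simp
    then have "A $$ (?j, ?k) \<noteq> 0"
      using pattern[of ?k ?j] grid_neighbours_iff[of "c + Suc s" m "c + s" r r] Suc.prems i by simp
    then have "tracked_level A ?j ?k \<le> enat 0"
      by (simp add: tracked_level_edge zero_enat_def[symmetric])
    moreover have "tracked_level A ?i ?k \<le> enat s" using Suc by (simp add: add.assoc)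
    ultimately show ?case
      using tracked_level_eliminate[of ?k ?j A ?i s 0] by (simp add: add.assoc)
  qed
qed

text \<open>
  The direct path along the row would pass between the two vertices and thus above the smaller one;
  the detour through the preceding row costs two extra steps.
\<close>

lemma tracked_level_same_row_le:
  assumes pattern: "\<And>i j. j < i \<Longrightarrow> i < m\<^sup>2 \<Longrightarrow> A $$ (i, j) \<noteq> 0 \<longleftrightarrow> grid_neighbours m i j"
    and "r + 1 < m" "c + s < m"
  shows "tracked_level A ((r + 1) * m + c + s) ((r + 1) * m + c) \<le> enat (s + 1)"
proof -
  let ?i = "(r + 1) * m + (c + s)" and ?j = "(r + 1) * m + c" and ?k = "r * m + (c + s)"
  have "(r + 1) * m + m \<le> m * m"
    using mult_le_mono1[of "r + 2" m m] assms(2) by (simp add: add_mult_distrib)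
  then have i: "?i < m\<^sup>2" using assms(3) by (simp add: power2_eq_square)
  have "A $$ (?i, ?k) \<noteq> 0"
    using pattern[OF _ i, of ?k] grid_neighbours_iff[of "c + s" m "c + s" "r + 1" r] assms(3) by simp
  then have "tracked_level A ?i ?k \<le> enat 0"
    by (simp add: tracked_level_edge zero_enat_def[symmetric])
  moreover have "tracked_level A ?j ?k \<le> enat s"
    using tracked_level_next_row_le[OF assms] by (simp add: add.assoc)
  ultimately show ?thesis
    using tracked_level_eliminate[of ?k ?j A ?i 0 s] assms(3) by (simp add: add.assoc)
qed

text \<open>
  The part of the matrix that belongs to the first grid row is tridiagonal, and tridiagonal matrices
  have no fill-in.
\<close>

lemma tracked_level_first_row:
  assumes pattern: "\<And>i j. j < i \<Longrightarrow> i < m\<^sup>2 \<Longrightarrow> A $$ (i, j) \<noteq> 0 \<longleftrightarrow> grid_neighbours m i j"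
    and fin: "tracked_level A i j \<noteq> \<infinity>" and ij: "j < i" "i < m"
  shows "A $$ (i, j) \<noteq> 0"
proof -
  have mm: "m \<le> m\<^sup>2" by (cases m) (auto simp: power2_eq_square)
  have tridiag: "i' \<le> j' + 1" if "j' < i'" "i' < m" "A $$ (i', j') \<noteq> 0" for i' j'
  proof -
    have "grid_neighbours m i' j'" using that pattern[of j' i'] mm by simp
    then show ?thesis using that(1,2) by (cases rule: grid_neighbours_cases) simp_all
  qed
  have "i = j + 1"
    using tracked_level_bandwidth[OF fin ij tridiag] ij by simp
  then show ?thesis
    using pattern[of j i] ij mm by (simp add: grid_neighbours_def node_x_def node_y_def)
qed

section \<open>Counting the positions of high level\<close>

text \<open>
  All positions are covered by the image of \<open>m - 1\<close> copies of a square of side \<open>m + 1 - p\<close>: the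
  pairs \<open>u \<le> v\<close> encode positions within one row, the pairs \<open>v < u\<close> positions in two
  consecutive rows.
\<close>

lemma card_levels_ge_le:
  assumes pattern: "\<And>i j. j < i \<Longrightarrow> i < m\<^sup>2 \<Longrightarrow> A $$ (i, j) \<noteq> 0 \<longleftrightarrow> grid_neighbours m i j"
    and p: "1 \<le> p" "p \<le> m"
  defines "F \<equiv> {(i, j). j < i \<and> i < m\<^sup>2 \<and> A $$ (i, j) = 0 \<and>
    tracked_level A i j \<noteq> \<infinity> \<and> enat p \<le> tracked_level A i j}"
  shows "finite F" and "card F \<le> (m - 1) * (m + 1 - p)\<^sup>2"
proof -
  define q where "q = m + 1 - p"
  define D where "D = {..<m - 1} \<times> {..<q} \<times> {..<q}"
  \<comment> \<open>A position within a row is charged to the preceding row, so both branches use the rows below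
    \<open>m - 1\<close>. The shift by \<open>p - 1\<close> turns separation at least \<open>p - 1\<close> into \<open>u \<le> v\<close>, and
    separation at least \<open>p\<close> into \<open>v < u\<close>.\<close>
  define g where "g = (\<lambda>(r, u, v).
    if u \<le> v then ((r + 1) * m + (v + (p - 1)), (r + 1) * m + u)
    else ((r + 1) * m + v, r * m + (u + (p - 1))))"
  have "F \<subseteq> g ` D"
  proof
    fix x assume "x \<in> F"
    then obtain i j where x: "x = (i, j)" and ij: "j < i" "i < m\<^sup>2" and zero: "A $$ (i, j) = 0"
      and fin: "tracked_level A i j \<noteq> \<infinity>" and lev: "enat p \<le> tracked_level A i j"
      by (auto simp: F_def)
    define r c r' c' where rc: "r = j div m" "c = j mod m" "r' = i div m" "c' = i mod m"
    have i: "i = r' * m + c'" and j: "j = r * m + c" by (simp_all add: rc)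
    have c: "c < m" "c' < m" using p by (simp_all add: rc)
    have r': "r' < m" using ij(2) by (simp add: rc power2_eq_square less_mult_imp_div_less)
    have "i \<le> j + m"
    proof (rule tracked_level_bandwidth[OF fin ij])
      fix i j assume edge: "j < i" "i < m\<^sup>2" "A $$ (i, j) \<noteq> 0"
      then have "grid_neighbours m i j" using pattern by blast
      then show "i \<le> j + m"
        using edge(1) p by (cases rule: grid_neighbours_cases) simp_all
    qed
    then have "r' \<le> r + 1" using div_le_mono[of i "j + m" m] p by (simp add: rc)
    moreover have "r \<le> r'" using div_le_mono[of j i m] ij by (simp add: rc)
    ultimately consider "r' = r" | "r' = r + 1" by linarith
    then show "x \<in> g ` D"
    proof cases
      case 1
      have "r \<noteq> 0"
      proof
        assume "r = 0"
        then have "i < m" using 1 i c by simp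
        then show False using tracked_level_first_row[OF pattern fin ij(1)] zero by blast
      qed
      then obtain r0 where r0: "r = r0 + 1" by (metis Suc_eq_plus1 not0_implies_Suc)
      define s where "s = c' - c"
      have s: "c' = c + s" using ij(1) i j 1 by (simp add: s_def)
      have "tracked_level A i j \<le> enat (s + 1)"
        using tracked_level_same_row_le[OF pattern, of r0 c s] r' c s r0 1 i j by (simp add: add.assoc)
      with lev have "enat p \<le> enat (s + 1)" by (rule order_trans)
      then have ps: "p \<le> s + 1" by simp
      have "x = g (r0, c, c' - (p - 1))" using x i j r0 1 s ps by (simp add: g_def)
      moreover have "(r0, c, c' - (p - 1)) \<in> D"
        using r' r0 1 c s ps p by (auto simp: D_def q_def)
      ultimately show ?thesis by blast
    next
      case 2
      have "c' \<le> c" using \<open>i \<le> j + m\<close> i j 2 by simp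
      define s where "s = c - c'"
      have s: "c = c' + s" using \<open>c' \<le> c\<close> by (simp add: s_def)
      have "tracked_level A i j \<le> enat s"
        using tracked_level_next_row_le[OF pattern, of r c' s] r' c s 2 i j by (simp add: add.assoc)
      with lev have "enat p \<le> enat s" by (rule order_trans)
      then have ps: "p \<le> s" by simp
      have "\<not> c - (p - 1) \<le> c'" using s ps p by simp
      then have "x = g (r, c - (p - 1), c')" using x i j 2 s ps p by (simp add: g_def)
      moreover have "(r, c - (p - 1), c') \<in> D"
        using r' 2 c s ps p by (auto simp: D_def q_def)
      ultimately show ?thesis by blast
    qed
  qed
  moreover have "finite D" by (simp add: D_def)
  moreover have "card D = (m - 1) * q\<^sup>2" by (simp add: D_def power2_eq_square)
  ultimately show "finite F" "card F \<le> (m - 1) * (m + 1 - p)\<^sup>2"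
    using surj_card_le[of D F g] by (auto simp: q_def intro: finite_subset)
qed

section \<open>Fill-in entries of given magnitude\<close>

lemma fill_in_strictly_lower:
  assumes chol: "cholesky_factor A L" and diag: "\<And>i. i < dim_row A \<Longrightarrow> A $$ (i, i) \<noteq> 0"
    and fill: "(i, j) \<in> fill_in A L"
  shows "j < i" "i < dim_row A" "A $$ (i, j) = 0"
proof -
  have ij: "i < dim_row A" "j < dim_row A" "A $$ (i, j) = 0" "L $$ (i, j) \<noteq> 0"
    using fill by (simp_all add: fill_in_def)
  have "L $$ (i, j) = 0" if "i < j"
    using chol[unfolded cholesky_factor_def, THEN conjunct2, THEN conjunct1] ij that by blast
  moreover have "i \<noteq> j" using diag ij by blast
  ultimately show "j < i" "i < dim_row A" "A $$ (i, j) = 0"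
    using ij by (auto intro: linorder_cases[of i j])
qed

text \<open>
  Membership in a magnitude set is a statement about the whole regime of small parameters, so the
  parameter may tend to zero with the mesh fixed; there the leading order decides. The level refers to
  one fixed parameter \<open>\<epsilon>\<close>, which is harmless because the sparsity pattern is the same for all of them.
\<close>

lemma magnitude_set_tracked_level:
  assumes "\<beta> > 0" "\<And>x y. x \<in> {0<..<1} \<Longrightarrow> y \<in> {0<..<1} \<Longrightarrow> b x y \<ge> \<beta>\<^sup>2"
    and \<delta>: "\<delta> > 0" and N: "N \<ge> 2"
    and chol: "\<And>e. small_eps \<delta> N e \<Longrightarrow> cholesky_factor (fd_matrix b N e) (L N e)"
    and eps: "\<epsilon> > 0" and c: "c\<^sub>0 > 0" "c\<^sub>1 > 0"
    and ij: "j < i" "i < (N - 1)\<^sup>2" and mag: "(i, j) \<in> magnitude_set L \<delta> c\<^sub>0 c\<^sub>1 N k"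
  shows "tracked_level (fd_matrix b N \<epsilon>) i j = enat k"
proof -
  let ?h = "mesh_width N" and ?B = "fd_matrix b N \<epsilon>"
  let ?d = "\<lambda>i. ?h\<^sup>2 * b (real (node_x (N - 1) i) * ?h) (real (node_y (N - 1) i) * ?h)"
  have h: "?h > 0" using N by (simp add: mesh_width_def)
  have small: "\<forall>\<^sub>F e in at_right 0. small_eps \<delta> N e"
    unfolding eventually_at_right_field
    by (intro exI[of _ "\<delta> * ?h"]) (use \<delta> h in \<open>auto simp: small_eps_def\<close>)
  have order: "leading_order (\<lambda>e. - L N e $$ (i, j)) (tracked_level ?B i j + 1)"
  proof (rule cholesky_leading_order[where A = "fd_matrix b N" and n = "(N - 1)\<^sup>2" and d = ?d])
    show "\<forall>\<^sub>F e in at_right 0. cholesky_factor (fd_matrix b N e) (L N e)"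
      using small by (rule eventually_mono) (rule chol)
    show "((\<lambda>e. fd_matrix b N e $$ (i, i)) \<longlongrightarrow> ?d i) (at_right 0)" if "i < (N - 1)\<^sup>2" for i
    proof -
      have "((\<lambda>e. 4 * e\<^sup>2 + ?d i) \<longlongrightarrow> 4 * 0\<^sup>2 + ?d i) (at_right 0)" by (intro tendsto_intros)
      then show ?thesis using fd_matrix_diag[OF that] by simp
    qed
    show "?d i > 0" if "i < (N - 1)\<^sup>2" for i using assms(1,2) that by (rule reaction_pos)
  qed (use ij eps in \<open>auto simp: fd_matrix_dim fd_matrix_offdiag\<close>)
  define H where "H = ?h ^ (2 * k + 1)"
  have H: "H > 0" using h by (simp add: H_def)
  have bounds: "\<forall>\<^sub>F e in at_right 0. c\<^sub>0 / H * e ^ (2 * (k + 1)) \<le> \<bar>L N e $$ (i, j)\<bar> \<and>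
      \<bar>L N e $$ (i, j)\<bar> \<le> c\<^sub>1 / H * e ^ (2 * (k + 1))"
    using small
  proof (rule eventually_mono)
    fix e assume e: "small_eps \<delta> N e"
    then have "\<bar>magnitude k N e\<bar> = e ^ (2 * (k + 1)) / H"
      using H unfolding magnitude_def H_def[symmetric] small_eps_def by simp
    then show "c\<^sub>0 / H * e ^ (2 * (k + 1)) \<le> \<bar>L N e $$ (i, j)\<bar> \<and>
      \<bar>L N e $$ (i, j)\<bar> \<le> c\<^sub>1 / H * e ^ (2 * (k + 1))"
      using mag e by (auto simp: magnitude_set_def)
  qed
  have "tracked_level ?B i j + 1 = enat (k + 1)"
    using order
  proof (rule leading_order_unique)
    show "c\<^sub>0 / H > 0" "c\<^sub>1 / H > 0" using c H by simp_all
    show "\<forall>\<^sub>F e in at_right 0. c\<^sub>0 / H * e ^ (2 * (k + 1)) \<le> \<bar>- L N e $$ (i, j)\<bar> \<and>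
      \<bar>- L N e $$ (i, j)\<bar> \<le> c\<^sub>1 / H * e ^ (2 * (k + 1))"
      using bounds by simp
  qed
  then show ?thesis by (cases "tracked_level ?B i j") (auto simp: one_enat_def)
qed

theorem theorem2:
  fixes b :: "real \<Rightarrow> real \<Rightarrow> real"
    and \<beta> \<delta> :: real
    and L :: "nat \<Rightarrow> real \<Rightarrow> real mat"
    and C\<^sub>0 C\<^sub>1 :: "nat \<Rightarrow> real"
    and N m p :: nat
    and \<epsilon> :: real
  assumes "\<beta> > 0"
    and "\<And>x y. x \<in> {0<..<1} \<Longrightarrow> y \<in> {0<..<1} \<Longrightarrow> b x y \<ge> \<beta>\<^sup>2"
    and "\<delta> > 0"
    and "\<exists>c\<^sub>0>0. \<exists>c\<^sub>1>0. \<forall>n\<ge>2. \<forall>e. small_eps \<delta> n e \<longrightarrow>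
           (\<forall>r < (n - 1)\<^sup>2. c\<^sub>0 * (mesh_width n)\<^sup>2 \<le> \<bar>fd_matrix b n e $$ (r, r)\<bar> \<and>
                            \<bar>fd_matrix b n e $$ (r, r)\<bar> \<le> c\<^sub>1 * (mesh_width n)\<^sup>2)"
    and "\<And>n e. n \<ge> 2 \<Longrightarrow> small_eps \<delta> n e \<Longrightarrow> cholesky_factor (fd_matrix b n e) (L n e)"
    and "\<And>k. C\<^sub>0 k > 0" and "\<And>k. C\<^sub>1 k > 0"
    and "N \<ge> 2" and "m = N - 1" and "small_eps \<delta> N \<epsilon>" and "p \<ge> 1"
  shows
    "int (\<Sum>k = p..m. card (fill_in (fd_matrix b N \<epsilon>) (L N \<epsilon>) \<inter>
                             magnitude_set L \<delta> (C\<^sub>0 k) (C\<^sub>1 k) N k))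
       \<le> (int m - 1) * (int m - int p + 1)\<^sup>2 \<and>
     int (\<Sum>k = p..m. card {(i, j) \<in> fill_in (fd_matrix b N \<epsilon>) (L N \<epsilon>).
                             tracked_level (fd_matrix b N \<epsilon>) i j = enat k})
       \<le> (int m - 1) * (int m - int p + 1)\<^sup>2"
proof -
  let ?A = "fd_matrix b N \<epsilon>"
  let ?S = "\<lambda>k. {(i, j) \<in> fill_in ?A (L N \<epsilon>). tracked_level ?A i j = enat k}"
  let ?M = "\<lambda>k. fill_in ?A (L N \<epsilon>) \<inter> magnitude_set L \<delta> (C\<^sub>0 k) (C\<^sub>1 k) N k"
  let ?F = "{(i, j). j < i \<and> i < m\<^sup>2 \<and> ?A $$ (i, j) = 0 \<and>
    tracked_level ?A i j \<noteq> \<infinity> \<and> enat p \<le> tracked_level ?A i j}"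
  have eps: "\<epsilon> > 0" using assms(10) by (simp add: small_eps_def)
  have chol: "cholesky_factor ?A (L N \<epsilon>)" using assms(5,8,10) by blast
  have dim: "dim_row ?A = m\<^sup>2" using assms(9) by (simp add: fd_matrix_dim)
  have diag: "?A $$ (i, i) \<noteq> 0" if "i < dim_row ?A" for i
  proof -
    have i: "i < (N - 1)\<^sup>2" using that by (simp add: fd_matrix_dim)
    have "4 * \<epsilon>\<^sup>2 \<ge> 0" by simp
    with reaction_pos[OF assms(1,2) i] have "?A $$ (i, i) > 0"
      unfolding fd_matrix_diag[OF i] by (intro add_nonneg_pos)
    then show ?thesis by simp
  qed
  note lower = fill_in_strictly_lower[OF chol diag]
  have pattern: "?A $$ (i, j) \<noteq> 0 \<longleftrightarrow> grid_neighbours m i j" if "j < i" "i < m\<^sup>2" for i j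
    using that eps assms(9) by (simp add: fd_matrix_offdiag)
  have fin: "finite (?S k)" for k
  proof (rule finite_subset)
    show "?S k \<subseteq> {..<m\<^sup>2} \<times> {..<m\<^sup>2}" by (auto simp: fill_in_def dim)
  qed simp
  have tracked: "int (\<Sum>k = p..m. card (?S k)) \<le> (int m - 1) * (int m - int p + 1)\<^sup>2"
  proof (cases "p \<le> m")
    case True
    have "(\<Sum>k = p..m. card (?S k)) = card (\<Union>k\<in>{p..m}. ?S k)"
      by (rule card_UN_disjoint[symmetric]) (use fin in auto)
    also have "\<dots> \<le> card ?F"
    proof (rule card_mono)
      show "finite ?F" using card_levels_ge_le(1)[OF pattern assms(11) True] .
      show "(\<Union>k\<in>{p..m}. ?S k) \<subseteq> ?F"
        using lower dim by auto
    qed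
    also have "\<dots> \<le> (m - 1) * (m + 1 - p)\<^sup>2"
      using card_levels_ge_le(2)[OF pattern assms(11) True] .
    finally have "int (\<Sum>k = p..m. card (?S k)) \<le> int ((m - 1) * (m + 1 - p)\<^sup>2)"
      by (rule of_nat_mono)
    also have "\<dots> = (int m - 1) * (int m - int p + 1)\<^sup>2"
      using True assms(11) by (simp add: of_nat_diff algebra_simps)
    finally show ?thesis .
  next
    case False
    then show ?thesis using assms(8,9) by simp
  qed
  have "?M k \<subseteq> ?S k" for k
  proof
    fix x assume x: "x \<in> ?M k"
    obtain i j where ij: "x = (i, j)" by (cases x)
    with x have mem: "(i, j) \<in> fill_in ?A (L N \<epsilon>)"
      "(i, j) \<in> magnitude_set L \<delta> (C\<^sub>0 k) (C\<^sub>1 k) N k" by auto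
    have "i < (N - 1)\<^sup>2" using lower(2)[OF _ mem(1)] by (simp add: fd_matrix_dim)
    from magnitude_set_tracked_level[where L = L, OF assms(1,2,3,8) assms(5)[OF assms(8)] eps
        assms(6,7) lower(1)[OF _ mem(1)] this mem(2)]
    show "x \<in> ?S k" using mem(1) ij by simp
  qed
  then have "(\<Sum>k = p..m. card (?M k)) \<le> (\<Sum>k = p..m. card (?S k))"
    by (intro sum_mono card_mono fin)
  then have "int (\<Sum>k = p..m. card (?M k)) \<le> (int m - 1) * (int m - int p + 1)\<^sup>2"
    using tracked by linarith
  with tracked show ?thesis by (rule conjI[rotated])
qed

end
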